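(* Let $n\geq 4$ and let $g_0$ be the largest positive integer such that $\frac{3g_0^2-g_0+2}{2g_0}<n$. Let $G$ be a lollipop graph on $n$ vertices, i.e. $G$ is isomorphic to $U_{n,g}^l$ for some $3\leq g<n$. Then $$F(U_{n,3}^l)\leq F(G)\leq F(U_{n,g_0+1}^l),$$ with equality on the left if and only if $G$ is isomorphic to $U_{n,3}^l$, and equality on the right if and only if $G$ is isomorphic to $U_{n,g_0+1}^l$.
   Context: All graphs are finite, simple and undirected. The lollipop graph $U_{n,g}^l$ ($3\leq g<n$) is obtained from the cycle $C_g$ and a path on $n-g+1$ vertices by identifying one end vertex of the path with a vertex of the cycle. A connected subgraph of a graph $G=(V,E)$ is a graph $(V',E')$ with $\emptyset\neq V'\subseteq V$, $E'\subseteq E$, every edge of $E'$ having both endpoints in $V'$, and $(V',E')$ connected; distinct pairs $(V',E')$ are counted separately. The core index $F(G)$ is the number of connected subgraphs of $G$. *)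

theory Defs
  imports Complex_Main "Graph_Theory.Graph_Theory"
begin

text \<open>
  A finite simple undirected graph is a \<^locale>\<open>pair_graph\<close>: an edge between \<open>u\<close> and \<open>v\<close> is
  represented by the two arcs \<open>(u, v)\<close> and \<open>(v, u)\<close>.

  In the lollipop graph the cycle runs through the vertices \<open>0, \<dots>, g - 1\<close> and the path through
  the \<open>n - g + 1\<close> vertices \<open>g - 1, \<dots>, n - 1\<close>, so that \<open>g - 1\<close> is the identified vertex.
  The definition is meaningful for \<open>3 \<le> g < n\<close>.
\<close>

definition lollipop :: "nat \<Rightarrow> nat \<Rightarrow> nat pair_pre_digraph" where
  "lollipop n g = mk_symmetric (with_proj
     \<lparr> pverts = {0..<n},
       parcs = {(i, Suc i mod g) | i. i < g} \<union> {(i, Suc i) | i. g - 1 \<le> i \<and> i < n - 1} \<rparr>)"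

text \<open>
  Requiring \<^term>\<open>pair_graph H\<close> makes the arc set of \<open>H\<close> symmetric, so that these \<open>H\<close> correspond
  bijectively to the undirected subgraphs \<open>(V', E')\<close>; the library notion of connectedness
  excludes the null graph.
\<close>

definition core_index :: "'a pair_pre_digraph \<Rightarrow> nat" where
  "core_index G = card {H :: 'a pair_pre_digraph.
     pair_graph H \<and> subgraph (with_proj H) (with_proj G) \<and>
     Digraph_Component.connected (with_proj H)}"

abbreviation graph_iso :: "'a pair_pre_digraph \<Rightarrow> 'b pair_pre_digraph \<Rightarrow> bool" where
  "graph_iso G H \<equiv> digraph_iso (with_proj G) (with_proj H)"

lemma pverts_lollipop [simp]: "pverts (lollipop n g) = {0..<n}"
  by (simp add: lollipop_def)

lemma pair_graph_lollipop:
  assumes "3 \<le> g" "g < n"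
  shows "pair_graph (lollipop n g)"
proof -
  let ?D = "\<lparr> pverts = {0..<n},
       parcs = {(i, Suc i mod g) | i. i < g} \<union> {(i, Suc i) | i. g - 1 \<le> i \<and> i < n - 1} \<rparr>"
  have lt: "Suc i mod g < n" for i
    using assms by (simp add: less_trans[OF mod_less_divisor])
  have ne: "i \<noteq> Suc i mod g" if "i < g" for i
    using that assms by (cases "Suc i = g") auto
  have wf: "pair_wf_digraph ?D"
    using assms lt by unfold_locales auto
  have lf: "fst e \<noteq> snd e" if "e \<in> parcs ?D" for e
    using that ne by fastforce
  have fin: "finite (parcs ?D)"
    by (rule finite_subset[of _ "{0..<n} \<times> {0..<n}"])
      (use wf in \<open>auto simp: pair_wf_digraph_def\<close>)
  have "pair_digraph ?D"
    using wf lf fin by (auto simp: pair_digraph_def pair_fin_digraph_def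
        pair_fin_digraph_axioms_def pair_loopfree_digraph_def pair_loopfree_digraph_axioms_def)
  then interpret D: pair_digraph ?D .
  have "pair_digraph (lollipop n g)"
    unfolding lollipop_def by (rule D.digraph_mk_symmetric)
  moreover have "symmetric (with_proj (lollipop n g))"
    unfolding lollipop_def by (rule symmetric_mk_symmetric)
  ultimately show ?thesis
    by (auto simp: pair_graph_def pair_pseudo_graph_def pair_sym_digraph_def
        pair_sym_digraph_axioms_def pair_digraph_def pair_fin_digraph_def)
qed

end

theory Submission
  imports Defs
begin

text \<open>
  Attaching a pendant vertex \<open>v\<close> at \<open>u\<close> adds to the connected subgraphs the single vertex \<open>v\<close> and
  one subgraph for each connected subgraph through \<open>u\<close>. The connected subgraphs of \<open>C\<^sub>g\<close> are the
  cycle itself and the \<open>g\<^sup>2\<close> arcs, given by a starting vertex and a length, and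
  \<open>g (g + 1) / 2 + 1\<close> of them pass through a given vertex. Growing the tail of length \<open>m = n - g\<close>
  vertex by vertex yields \<open>2 F = 2 g\<^sup>2 + 2 + m (g\<^sup>2 + g + 2) + m (m + 1)\<close>. For fixed \<open>n\<close> the
  difference of consecutive values in \<open>g\<close> is \<open>2 g n - 3 g\<^sup>2 + g - 2\<close>, which changes sign exactly at
  \<open>g\<^sub>0\<close> and vanishes for no \<open>g \<ge> 3\<close>, as it would force \<open>g\<close> to divide 2.
  The lower bound follows from \<open>2 F(g) - 2 F(3) = (g - 3) (g - 6 + m (g + 2))\<close>.
\<close>

section \<open>Connected subgraphs as pairs\<close>

text \<open>Records are replaced by plain pairs and reachability by \<open>\<^sup>*\<close>, so that
  counting and walk arguments use only sets and relations.\<close>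

definition conn_pairs :: "'a set \<Rightarrow> 'a rel \<Rightarrow> ('a set \<times> 'a rel) set" where
  "conn_pairs V\<^sub>0 E\<^sub>0 = {(V, E). V \<noteq> {} \<and> V \<subseteq> V\<^sub>0 \<and> E \<subseteq> E\<^sub>0 \<and> sym E \<and> E \<subseteq> V \<times> V \<and>
     (\<forall>u\<in>V. \<forall>v\<in>V. (u, v) \<in> E\<^sup>*)}"

lemma finite_conn_pairs:
  assumes "finite V\<^sub>0" "finite E\<^sub>0"
  shows "finite (conn_pairs V\<^sub>0 E\<^sub>0)"
  by (rule finite_subset[of _ "Pow V\<^sub>0 \<times> Pow E\<^sub>0"]) (use assms in \<open>auto simp: conn_pairs_def\<close>)

text \<open>\<open>rtrancl_on V E\<close> is reflexive only on \<open>V\<close>; a walk that starts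
  in \<open>V\<close> never leaves it, as all arcs lie within \<open>V\<close>.\<close>

lemma rtrancl_on_iff_rtrancl:
  assumes "E \<subseteq> V \<times> V" "u \<in> V"
  shows "(u, v) \<in> rtrancl_on V E \<longleftrightarrow> (u, v) \<in> E\<^sup>*"
proof
  assume "(u, v) \<in> E\<^sup>*"
  then show "(u, v) \<in> rtrancl_on V E"
    by (induction rule: rtrancl_induct) (use assms in \<open>auto intro: rtrancl_on_into_rtrancl_on\<close>)
qed (rule rtrancl_on_rtranclI)

text \<open>The library defines connectedness as strong connectedness of the symmetric closure,
  which adds nothing to an already symmetric arc set.\<close>

lemma connected_pair_graph_iff:
  assumes "pair_graph H"
  shows "Digraph_Component.connected (with_proj H) \<longleftrightarrow>
    pverts H \<noteq> {} \<and> (\<forall>u\<in>pverts H. \<forall>v\<in>pverts H. (u, v) \<in> (parcs H)\<^sup>*)"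
proof -
  interpret pair_graph H by fact
  have sub: "parcs H \<subseteq> pverts H \<times> pverts H"
    by (auto dest: in_arcsD1 in_arcsD2)
  have "parcs (mk_symmetric (with_proj H)) = parcs H"
    using adj_mk_symmetric_eq pair_sym_arcs by simp
  then show ?thesis
    using rtrancl_on_iff_rtrancl[OF sub]
    by (auto simp: Digraph_Component.connected_def strongly_connected_def reachable_def)
qed

lemma core_index_eq_card_conn_pairs:
  assumes "pair_graph G"
  shows "core_index G = card (conn_pairs (pverts G) (parcs G))"
proof -
  interpret G: pair_graph G by fact
  have "bij_betw (\<lambda>H. (pverts H, parcs H))
      {H. pair_graph H \<and> subgraph (with_proj H) (with_proj G) \<and>
        Digraph_Component.connected (with_proj H)}
      (conn_pairs (pverts G) (parcs G))" (is "bij_betw ?f ?A ?B")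
  proof (rule bij_betwI[where g = "\<lambda>(V, E). \<lparr>pverts = V, parcs = E\<rparr>"])
    show "?f \<in> ?A \<rightarrow> ?B"
    proof
      fix H assume H: "H \<in> ?A"
      then interpret H: pair_graph H by simp
      have "sym (parcs H)"
        using H.pair_sym_arcs by (simp add: symmetric_def)
      then show "?f H \<in> ?B"
        using H connected_pair_graph_iff[OF H.pair_graph_axioms]
        by (auto simp: conn_pairs_def subgraph_def dest: H.in_arcsD1 H.in_arcsD2)
    qed
    show "(\<lambda>(V, E). \<lparr>pverts = V, parcs = E\<rparr>) \<in> ?B \<rightarrow> ?A"
    proof
      fix X assume X: "X \<in> ?B"
      obtain V E where [simp]: "X = (V, E)" by fastforce
      let ?H = "\<lparr>pverts = V, parcs = E\<rparr>"
      have VE: "V \<noteq> {}" "V \<subseteq> pverts G" "E \<subseteq> parcs G" "sym E" "E \<subseteq> V \<times> V"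
          "\<forall>u\<in>V. \<forall>v\<in>V. (u, v) \<in> E\<^sup>*"
        using X by (auto simp: conn_pairs_def)
      have fin: "finite V" "finite E"
        using VE G.pair_finite_verts G.pair_finite_arcs finite_subset by blast+
      have H: "pair_graph ?H"
        using VE fin G.pair_no_loops by unfold_locales (auto simp: symmetric_def)
      then interpret H: pair_graph ?H .
      have "subgraph (with_proj ?H) (with_proj G)"
        using VE G.wf_digraph H.wf_digraph by (auto simp: subgraph_def)
      then show "(case X of (V, E) \<Rightarrow> \<lparr>pverts = V, parcs = E\<rparr>) \<in> ?A"
        using H VE connected_pair_graph_iff[OF H] by simp
    qed
  qed auto
  then show ?thesis
    unfolding core_index_def by (rule bij_betw_same_card)
qed

text \<open>A vertex map carries walks to walks, so connectedness passes to images.\<close>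

lemma conn_pairs_image:
  assumes "(V, E) \<in> conn_pairs V\<^sub>0 E\<^sub>0"
  shows "(f ` V, map_prod f f ` E) \<in> conn_pairs (f ` V\<^sub>0) (map_prod f f ` E\<^sub>0)"
proof -
  have VE: "V \<noteq> {}" "V \<subseteq> V\<^sub>0" "E \<subseteq> E\<^sub>0" "sym E" "E \<subseteq> V \<times> V"
      "\<forall>u\<in>V. \<forall>v\<in>V. (u, v) \<in> E\<^sup>*"
    using assms by (auto simp: conn_pairs_def)
  have "(f u, f v) \<in> (map_prod f f ` E)\<^sup>*" if "(u, v) \<in> E\<^sup>*" for u v
    using that
    by (induction rule: rtrancl_induct) (auto intro: rtrancl_into_rtrancl)
  moreover have "sym (map_prod f f ` E)"
    using VE(4) by (fastforce simp: sym_def)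
  ultimately show ?thesis
    using VE by (auto simp: conn_pairs_def)
qed

text \<open>An isomorphism induces an injection on connected pairs; equality follows later from the
  inverse isomorphism.\<close>

lemma core_index_le_if_graph_iso:
  assumes "pair_graph G" "pair_graph H" "graph_iso G H"
  shows "core_index G \<le> core_index H"
proof -
  interpret G: pair_graph G by fact
  interpret H: pair_graph H by fact
  obtain h where h: "pre_digraph.digraph_isomorphism (with_proj G) h"
      "with_proj H = app_iso h (with_proj G)"
    using assms(3) by (auto simp: digraph_iso_def)
  let ?f = "iso_verts h"
  have inj: "inj_on ?f (pverts G)"
    and ends: "\<And>e. e \<in> parcs G \<Longrightarrow> ?f (fst e) = iso_tail h (iso_arcs h e)"
      "\<And>e. e \<in> parcs G \<Longrightarrow> ?f (snd e) = iso_head h (iso_arcs h e)"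
    using h(1) by (auto simp: G.digraph_isomorphism_def)
  have "verts (with_proj H) = verts (app_iso h (with_proj G))"
      "arcs (with_proj H) = arcs (app_iso h (with_proj G))"
      "tail (with_proj H) = tail (app_iso h (with_proj G))"
      "head (with_proj H) = head (app_iso h (with_proj G))"
    by (simp_all only: h(2))
  \<comment> \<open>Arcs of \<open>H\<close> are pairs with ends \<open>fst\<close> and
    \<open>snd\<close>. Preservation of ends therefore forces the separate arc map of the
    isomorphism to act coordinatewise on \<open>parcs G\<close>.\<close>
  then have HG: "pverts H = ?f ` pverts G" "parcs H = iso_arcs h ` parcs G"
      "iso_tail h = fst" "iso_head h = snd"
    by (simp_all add: app_iso_def)
  have "iso_arcs h e = map_prod ?f ?f e" if "e \<in> parcs G" for e
    using ends[OF that] HG by (simp add: prod_eq_iff)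
  then have arcs: "parcs H = map_prod ?f ?f ` parcs G"
    using HG(2) by simp
  have sub: "parcs G \<subseteq> pverts G \<times> pverts G"
    by (auto dest: G.in_arcsD1 G.in_arcsD2)
  let ?F = "\<lambda>(V, E). (?f ` V, map_prod ?f ?f ` E)"
  have "inj_on ?F (conn_pairs (pverts G) (parcs G))"
  proof (rule inj_on_subset)
    have "inj_on (map_prod ?f ?f) (parcs G)"
      using map_prod_inj_on[OF inj inj] sub by (rule inj_on_subset)
    then show "inj_on ?F (Pow (pverts G) \<times> Pow (parcs G))"
      using inj by (auto simp: inj_on_def inj_on_image_eq_iff)
  qed (auto simp: conn_pairs_def)
  moreover have "?F ` conn_pairs (pverts G) (parcs G) \<subseteq> conn_pairs (pverts H) (parcs H)"
    using conn_pairs_image HG(1) arcs by fastforce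
  moreover have "finite (conn_pairs (pverts H) (parcs H))"
    using H.pair_finite_verts H.pair_finite_arcs by (rule finite_conn_pairs)
  ultimately show ?thesis
    unfolding core_index_eq_card_conn_pairs[OF assms(1)] core_index_eq_card_conn_pairs[OF assms(2)]
    by (rule card_inj_on_le)
qed

lemma core_index_eq_if_graph_iso:
  assumes "pair_graph G" "pair_graph H" "graph_iso G H"
  shows "core_index G = core_index H"
proof (rule antisym)
  interpret G: pair_graph G by fact
  have "graph_iso H G"
    using G.wf_digraph assms(3) by (rule digraph_iso_swap)
  then show "core_index H \<le> core_index G"
    by (rule core_index_le_if_graph_iso[OF assms(2,1)])
qed (rule core_index_le_if_graph_iso[OF assms])

section \<open>Attaching a pendant vertex\<close>

text \<open>This second count has to be carried along: the gain from a pendant vertex depends on the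
  subgraphs through its neighbour.\<close>

definition conn_pairs_at :: "'a \<Rightarrow> 'a set \<Rightarrow> 'a rel \<Rightarrow> ('a set \<times> 'a rel) set" where
  "conn_pairs_at v V\<^sub>0 E\<^sub>0 = {X \<in> conn_pairs V\<^sub>0 E\<^sub>0. v \<in> fst X}"

locale pendant =
  fixes V\<^sub>0 :: "'a set" and E\<^sub>0 :: "'a rel" and u v :: 'a
  assumes fin: "finite V\<^sub>0" and sub: "E\<^sub>0 \<subseteq> V\<^sub>0 \<times> V\<^sub>0" and u: "u \<in> V\<^sub>0" and v: "v \<notin> V\<^sub>0"
begin

abbreviation attach :: "'a set \<times> 'a rel \<Rightarrow> 'a set \<times> 'a rel" where
  "attach X \<equiv> (insert v (fst X), snd X \<union> {(u, v), (v, u)})"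

lemma finE: "finite E\<^sub>0"
  using sub fin by (meson finite_SigmaI finite_subset)

lemma attach_in_conn_pairs:
  assumes "X \<in> conn_pairs_at u V\<^sub>0 E\<^sub>0"
  shows "attach X \<in> conn_pairs (insert v V\<^sub>0) (E\<^sub>0 \<union> {(u, v), (v, u)})"
proof -
  obtain V E where [simp]: "X = (V, E)" by fastforce
  have VE: "V \<noteq> {}" "V \<subseteq> V\<^sub>0" "E \<subseteq> E\<^sub>0" "sym E" "E \<subseteq> V \<times> V"
      "\<forall>u\<in>V. \<forall>v\<in>V. (u, v) \<in> E\<^sup>*" "u \<in> V"
    using assms by (auto simp: conn_pairs_def conn_pairs_at_def)
  let ?E = "E \<union> {(u, v), (v, u)}"
  have mono: "E\<^sup>* \<subseteq> ?E\<^sup>*"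
    by (rule rtrancl_mono) auto
  \<comment> \<open>The vertex \<open>u\<close> serves as a hub through which any two vertices are
    joined.\<close>
  have "(x, u) \<in> ?E\<^sup>* \<and> (u, x) \<in> ?E\<^sup>*" if "x \<in> insert v V" for x
    using that mono VE(6,7) by auto
  then have "\<forall>x\<in>insert v V. \<forall>y\<in>insert v V. (x, y) \<in> ?E\<^sup>*"
    by (meson rtrancl_trans)
  moreover have "sym ?E"
    using VE(4) by (auto simp: sym_def)
  ultimately show ?thesis
    using VE by (auto simp: conn_pairs_def)
qed

text \<open>A walk that visits \<open>v\<close> enters and leaves through \<open>u\<close>, so
  deleting \<open>v\<close> from a larger connected pair leaves a connected pair containing
  \<open>u\<close>.\<close>

lemma conn_pairs_through_pendant:
  assumes "(V, E) \<in> conn_pairs (insert v V\<^sub>0) (E\<^sub>0 \<union> {(u, v), (v, u)})" "v \<in> V"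
  shows "(V, E) = ({v}, {}) \<or> (V, E) \<in> attach ` conn_pairs_at u V\<^sub>0 E\<^sub>0"
proof (cases "V = {v}")
  case True
  moreover have "(v, v) \<notin> E\<^sub>0 \<union> {(u, v), (v, u)}"
    using sub u v by auto
  ultimately show ?thesis
    using assms by (auto simp: conn_pairs_def)
next
  case False
  have VE: "V \<noteq> {}" "V \<subseteq> insert v V\<^sub>0" "E \<subseteq> E\<^sub>0 \<union> {(u, v), (v, u)}" "sym E" "E \<subseteq> V \<times> V"
      "\<forall>u\<in>V. \<forall>v\<in>V. (u, v) \<in> E\<^sup>*"
    using assms by (auto simp: conn_pairs_def)
  \<comment> \<open>A second vertex forces an arc out of \<open>v\<close>, and \<open>u\<close> is
    its only possible target.\<close>
  obtain x where "x \<in> V" "x \<noteq> v"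
    using False assms(2) by blast
  then have "(v, x) \<in> E\<^sup>*"
    using VE(6) assms(2) by blast
  then obtain y where "(v, y) \<in> E"
    using \<open>x \<noteq> v\<close> by (auto elim: converse_rtranclE)
  then have vu: "(v, u) \<in> E" "(u, v) \<in> E"
    using VE(3,4) sub v by (auto dest: symD)
  define V' E' where "V' = V - {v}" and "E' = E - {(u, v), (v, u)}"
  have E': "E' \<subseteq> E\<^sub>0" "E' \<subseteq> V' \<times> V'" "sym E'"
    using VE(3-5) sub v by (auto simp: E'_def V'_def sym_def)
  \<comment> \<open>Retracting \<open>v\<close> onto \<open>u\<close> turns walks in \<open>E\<close> into walks avoiding \<open>v\<close>.\<close>
  define r where "r x = (if x = v then u else x)" for x
  have retract: "(r x, r y) \<in> E'\<^sup>*" if "(x, y) \<in> E\<^sup>*" for x y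
    using that
  proof (induction rule: rtrancl_induct)
    case (step y z)
    have "(r y, r z) \<in> E'\<^sup>*"
    proof (cases "(y, z) \<in> {(u, v), (v, u)}")
      case False
      then have "(y, z) \<in> E'" using step(2) by (simp add: E'_def)
      then show ?thesis using E'(2) by (auto simp: r_def V'_def)
    qed (auto simp: r_def)
    then show ?case using step(3) by (rule rtrancl_trans[rotated])
  qed auto
  have "(x, y) \<in> E'\<^sup>*" if "x \<in> V'" "y \<in> V'" for x y
    using retract[of x y] VE(6) that by (simp add: V'_def r_def)
  moreover have "u \<in> V'" "V' \<subseteq> V\<^sub>0"
    using vu VE(2,5) u v by (auto simp: V'_def)
  ultimately have "(V', E') \<in> conn_pairs_at u V\<^sub>0 E\<^sub>0"
    using E' by (auto simp: conn_pairs_def conn_pairs_at_def)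
  moreover have "(V, E) = attach (V', E')"
    using vu assms(2) by (auto simp: V'_def E'_def)
  ultimately show ?thesis by blast
qed

lemma conn_pairs_at_pendant:
  "conn_pairs_at v (insert v V\<^sub>0) (E\<^sub>0 \<union> {(u, v), (v, u)}) =
    insert ({v}, {}) (attach ` conn_pairs_at u V\<^sub>0 E\<^sub>0)" (is "?L = ?R")
proof
  show "?L \<subseteq> ?R"
    using conn_pairs_through_pendant unfolding conn_pairs_at_def by fastforce
  have "({v}, {}) \<in> ?L"
    by (auto simp: conn_pairs_at_def conn_pairs_def sym_def)
  then show "?R \<subseteq> ?L"
    using attach_in_conn_pairs by (auto simp: conn_pairs_at_def)
qed

text \<open>A pair that avoids \<open>v\<close> cannot use the new arcs and so already lives in the
  old graph.\<close>

lemma conn_pairs_pendant: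
  "conn_pairs (insert v V\<^sub>0) (E\<^sub>0 \<union> {(u, v), (v, u)}) =
    conn_pairs V\<^sub>0 E\<^sub>0 \<union> conn_pairs_at v (insert v V\<^sub>0) (E\<^sub>0 \<union> {(u, v), (v, u)})"
proof -
  have "E \<subseteq> E\<^sub>0" if "E \<subseteq> E\<^sub>0 \<union> {(u, v), (v, u)}" "E \<subseteq> V \<times> V" "v \<notin> V" for V E
    using that by blast
  then show ?thesis
    unfolding conn_pairs_at_def conn_pairs_def by auto blast
qed

lemma card_conn_pairs_at_pendant:
  "card (conn_pairs_at v (insert v V\<^sub>0) (E\<^sub>0 \<union> {(u, v), (v, u)})) =
    Suc (card (conn_pairs_at u V\<^sub>0 E\<^sub>0))"
proof -
  have new: "v \<notin> V" "(u, v) \<notin> E" "(v, u) \<notin> E" "V \<noteq> {}"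
    if "(V, E) \<in> conn_pairs_at u V\<^sub>0 E\<^sub>0" for V E
    using that sub v by (auto simp: conn_pairs_at_def conn_pairs_def)
  have "inj_on attach (conn_pairs_at u V\<^sub>0 E\<^sub>0)"
  proof (rule inj_onI, clarsimp)
    fix V E V' E'
    assume X: "(V, E) \<in> conn_pairs_at u V\<^sub>0 E\<^sub>0" "(V', E') \<in> conn_pairs_at u V\<^sub>0 E\<^sub>0"
      and eq: "insert v V = insert v V'" "insert (u, v) (insert (v, u) E) = insert (u, v) (insert (v, u) E')"
    \<comment> \<open>Removing what \<open>attach\<close> added recovers both components, since
      \<open>v\<close> and its arcs are new.\<close>
    have "insert v V - {v} = insert v V' - {v}"
        "insert (u, v) (insert (v, u) E) - {(u, v), (v, u)} =
          insert (u, v) (insert (v, u) E') - {(u, v), (v, u)}"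
      using eq by simp_all
    then show "V = V' \<and> E = E'"
      using new(1-3)[OF X(1)] new(1-3)[OF X(2)] by simp
  qed
  moreover have "({v}, {}) \<notin> attach ` conn_pairs_at u V\<^sub>0 E\<^sub>0"
    by auto
  moreover have "finite (conn_pairs_at u V\<^sub>0 E\<^sub>0)"
    using finite_conn_pairs[OF fin finE] by (simp add: conn_pairs_at_def)
  ultimately show ?thesis
    unfolding conn_pairs_at_pendant by (simp add: card_image)
qed

lemma card_conn_pairs_pendant:
  "card (conn_pairs (insert v V\<^sub>0) (E\<^sub>0 \<union> {(u, v), (v, u)})) =
    card (conn_pairs V\<^sub>0 E\<^sub>0) + Suc (card (conn_pairs_at u V\<^sub>0 E\<^sub>0))"
proof -
  have "conn_pairs V\<^sub>0 E\<^sub>0 \<inter> conn_pairs_at v (insert v V\<^sub>0) (E\<^sub>0 \<union> {(u, v), (v, u)}) = {}"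
    using v by (auto simp: conn_pairs_at_def conn_pairs_def)
  moreover have "finite (conn_pairs (insert v V\<^sub>0) (E\<^sub>0 \<union> {(u, v), (v, u)}))"
    using fin finE by (intro finite_conn_pairs) auto
  ultimately show ?thesis
    unfolding card_conn_pairs_at_pendant[symmetric]
    unfolding conn_pairs_pendant by (intro card_Un_disjoint) auto
qed

end

section \<open>Connected subgraphs of the cycle\<close>

definition cycle_arcs :: "nat \<Rightarrow> nat rel" where
  "cycle_arcs g = (\<Union>i<g. {(i, Suc i mod g), (Suc i mod g, i)})"

text \<open>For \<open>1 \<le> k\<close> and \<open>k \<le> g\<close> this is a path with
  \<open>k\<close> vertices and \<open>k - 1\<close> edges, running upwards from \<open>s\<close>.
  At \<open>k = g\<close> it spans the cycle but omits the closing edge, so it differs from the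
  whole cycle.\<close>

definition cycle_path :: "nat \<Rightarrow> nat \<Rightarrow> nat \<Rightarrow> nat set \<times> nat rel" where
  "cycle_path g s k = ((\<lambda>i. (s + i) mod g) ` {..<k},
     \<Union>i\<in>{i. Suc i < k}. {((s + i) mod g, (s + Suc i) mod g), ((s + Suc i) mod g, (s + i) mod g)})"

text \<open>The difference of \<open>i\<close> and \<open>j\<close> is a multiple of
  \<open>g\<close> smaller than \<open>g\<close>.\<close>

lemma mod_shift_inj:
  fixes s i j g :: nat
  assumes "(s + i) mod g = (s + j) mod g" "i < g" "j < g"
  shows "i = j"
  using assms
proof (induction i j rule: linorder_wlog)
  case (le i j)
  then have "g dvd (s + j) - (s + i)"
    by (metis mod_eq_dvd_iff_nat add_le_cancel_left)
  then show ?case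
    using le by (auto dest: dvd_imp_le)
qed auto

lemma Suc_mod_inj:
  fixes a b g :: nat
  assumes "Suc a mod g = Suc b mod g" "a < g" "b < g"
  shows "a = b"
  using mod_shift_inj[of 1 a g b] assms by simp

locale cycle_graph =
  fixes g :: nat
  assumes g: "3 \<le> g"
begin

abbreviation nxt :: "nat \<Rightarrow> nat" where "nxt x \<equiv> Suc x mod g"

lemma nxt_shift: "nxt ((s + i) mod g) = (s + Suc i) mod g"
  by (simp add: mod_Suc_eq)

text \<open>This is where \<open>3 \<le> g\<close> matters: it keeps forward and backward arcs of
  the cycle apart.\<close>

lemma nxt_nxt_neq: "x < g \<Longrightarrow> nxt (nxt x) \<noteq> x"
  using mod_shift_inj[of x 2 g 0] g by (auto simp: mod_Suc_eq)

lemma in_cycle_arcs_iff: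
  "(x, y) \<in> cycle_arcs g \<longleftrightarrow> x < g \<and> y < g \<and> (y = nxt x \<or> x = nxt y)"
  using g by (auto simp: cycle_arcs_def)

lemma nxt_arc_cycle_path_iff:
  assumes "x < g"
  shows "(x, nxt x) \<in> snd (cycle_path g s k) \<longleftrightarrow> (\<exists>i. Suc i < k \<and> x = (s + i) mod g)"
proof
  assume "(x, nxt x) \<in> snd (cycle_path g s k)"
  then obtain i where i: "Suc i < k" and
    "x = (s + i) mod g \<or> x = (s + Suc i) mod g \<and> nxt x = (s + i) mod g"
    by (auto simp: cycle_path_def)
  \<comment> \<open>A backward arc of the path that is also a forward arc of the cycle would make
    two steps return to \<open>x\<close>.\<close>
  moreover have False if "x = (s + Suc i) mod g" "nxt x = (s + i) mod g"
    using nxt_nxt_neq[OF assms] that nxt_shift[of s i] by simp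
  ultimately show "\<exists>i. Suc i < k \<and> x = (s + i) mod g" by blast
next
  assume "\<exists>i. Suc i < k \<and> x = (s + i) mod g"
  then show "(x, nxt x) \<in> snd (cycle_path g s k)"
    using nxt_shift by (force simp: cycle_path_def)
qed

text \<open>The starting vertex is recovered as the only vertex not entered in the direction of the cycle;
  the whole cycle has no such vertex.\<close>

lemma cycle_path_start:
  assumes "s < g" "1 \<le> k" "k \<le> g"
  shows "{x \<in> fst (cycle_path g s k). \<forall>y<g. x = nxt y \<longrightarrow> (y, x) \<notin> snd (cycle_path g s k)} = {s}"
    (is "?L = _")
proof
  have "s \<in> fst (cycle_path g s k)"
    using assms by (auto simp: cycle_path_def intro!: image_eqI[of _ _ 0])
  moreover have "(y, s) \<notin> snd (cycle_path g s k)" if y: "y < g" "s = nxt y" for y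
  proof
    assume "(y, s) \<in> snd (cycle_path g s k)"
    then obtain i where "Suc i < k" "y = (s + i) mod g"
      using y nxt_arc_cycle_path_iff by metis
    \<comment> \<open>An arc of the path entering \<open>s\<close> would mean a return to
      \<open>s\<close> after fewer than \<open>g\<close> steps.\<close>
    then have "(s + Suc i) mod g = (s + 0) mod g"
      using y(2) assms(1) nxt_shift[of s i] by simp
    then show False
      using mod_shift_inj[of s "Suc i" g 0] \<open>Suc i < k\<close> assms by simp
  qed
  ultimately show "{s} \<subseteq> ?L" by auto
  show "?L \<subseteq> {s}"
  proof
    fix x assume x: "x \<in> ?L"
    then obtain i where i: "i < k" "x = (s + i) mod g"
      by (auto simp: cycle_path_def)
    show "x \<in> {s}"
    proof (cases i)
      case 0
      then show ?thesis using i assms by simp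
    next
      case (Suc j)
      have "((s + j) mod g, x) \<in> snd (cycle_path g s k)"
        using i Suc by (force simp: cycle_path_def)
      moreover have "x = nxt ((s + j) mod g)"
        using nxt_shift i Suc by simp
      ultimately show ?thesis using x g by auto
    qed
  qed
qed

lemma card_cycle_path:
  assumes "k \<le> g"
  shows "card (fst (cycle_path g s k)) = k"
proof -
  have "inj_on (\<lambda>i. (s + i) mod g) {..<k}"
    using assms by (intro inj_onI) (rule mod_shift_inj[of s _ g], auto)
  then show ?thesis
    by (simp add: cycle_path_def card_image)
qed

text \<open>The start is the unique vertex not entered, and the length is the number of
  vertices.\<close>

lemma inj_on_cycle_path:
  "inj_on (\<lambda>(s, k). cycle_path g s k) ({..<g} \<times> {1..g})"
proof (rule inj_onI)
  fix p q
  assume pq: "p \<in> {..<g} \<times> {1..g}" "q \<in> {..<g} \<times> {1..g}"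
    "(case p of (s, k) \<Rightarrow> cycle_path g s k) = (case q of (s, k) \<Rightarrow> cycle_path g s k)"
  obtain s k s' k' where [simp]: "p = (s, k)" "q = (s', k')"
    by fastforce
  have eq: "cycle_path g s k = cycle_path g s' k'"
    using pq(3) by simp
  from pq have s: "s < g" "1 \<le> k" "k \<le> g" and s': "s' < g" "1 \<le> k'" "k' \<le> g"
    by auto
  have "{s} = {s'}"
    unfolding cycle_path_start[OF s, symmetric] cycle_path_start[OF s', symmetric] eq ..
  moreover have "k = k'"
    using card_cycle_path[OF s(3), of s] card_cycle_path[OF s'(3), of s'] eq by simp
  ultimately show "p = q" by simp
qed

lemma whole_cycle_not_path:
  assumes "s < g" "1 \<le> k" "k \<le> g"
  shows "cycle_path g s k \<noteq> ({..<g}, cycle_arcs g)"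
proof
  assume eq: "cycle_path g s k = ({..<g}, cycle_arcs g)"
  \<comment> \<open>The predecessor of \<open>s\<close>, written as \<open>g - 1\<close> forward
    steps; in the whole cycle its arc enters \<open>s\<close>.\<close>
  define y where "y = (s + (g - 1)) mod g"
  have "nxt y = (s + g) mod g"
    using nxt_shift[of s "g - 1"] g by (simp add: y_def)
  then have "s = nxt y" "y < g"
    using assms g by (auto simp: y_def)
  then have "(y, s) \<in> cycle_arcs g"
    using in_cycle_arcs_iff assms by simp
  then show False
    using cycle_path_start[OF assms] eq \<open>s = nxt y\<close> \<open>y < g\<close> by auto
qed

lemma cycle_path_in_conn_pairs:
  assumes "1 \<le> k"
  shows "cycle_path g s k \<in> conn_pairs {..<g} (cycle_arcs g)"
proof -
  obtain V E where VE: "cycle_path g s k = (V, E)" by fastforce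
  have V: "V = (\<lambda>i. (s + i) mod g) ` {..<k}"
    and E: "E = (\<Union>i\<in>{i. Suc i < k}. {((s + i) mod g, (s + Suc i) mod g), ((s + Suc i) mod g, (s + i) mod g)})"
    using VE by (auto simp: cycle_path_def)
  have sym: "sym E"
    unfolding E sym_def by blast
  \<comment> \<open>All vertices are reached from the start by walking forward; symmetry supplies
    the way back.\<close>
  have fwd: "(s mod g, (s + i) mod g) \<in> E\<^sup>*" if "i < k" for i
    using that
  proof (induction i)
    case (Suc i)
    then have "((s + i) mod g, (s + Suc i) mod g) \<in> E"
      unfolding E by blast
    then show ?case
      using Suc by (meson Suc_lessD rtrancl.rtrancl_into_rtrancl)
  qed simp
  then have "(x, y) \<in> E\<^sup>*" if "x \<in> V" "y \<in> V" for x y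
    using that sym_rtrancl[OF sym] unfolding V
    by (metis (no_types, lifting) imageE lessThan_iff rtrancl_trans symD)
  moreover have "E \<subseteq> cycle_arcs g"
  proof -
    have "((s + i) mod g, (s + Suc i) mod g) \<in> cycle_arcs g"
        "((s + Suc i) mod g, (s + i) mod g) \<in> cycle_arcs g" for i
      using g nxt_shift[of s i] by (simp_all add: in_cycle_arcs_iff)
    then show ?thesis
      unfolding E by blast
  qed
  moreover have "E \<subseteq> V \<times> V"
    unfolding E V by (auto simp del: add_Suc_right)
  moreover have "V \<noteq> {}" "V \<subseteq> {..<g}"
    using assms g unfolding V by (auto simp: lessThan_empty_iff)
  ultimately show ?thesis
    using sym VE by (auto simp: conn_pairs_def)
qed

text \<open>The cycle inherits connectedness from its spanning path
  \<open>cycle_path g 0 g\<close>.\<close>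

lemma whole_cycle_in_conn_pairs: "({..<g}, cycle_arcs g) \<in> conn_pairs {..<g} (cycle_arcs g)"
proof -
  have "cycle_path g 0 g \<in> conn_pairs {..<g} (cycle_arcs g)"
    using g by (intro cycle_path_in_conn_pairs) simp
  moreover have "fst (cycle_path g 0 g) = {..<g}"
    by (force simp: cycle_path_def)
  ultimately obtain E where "({..<g}, E) \<in> conn_pairs {..<g} (cycle_arcs g)"
    by (metis prod.collapse)
  then have "E \<subseteq> cycle_arcs g" "\<forall>u<g. \<forall>v<g. (u, v) \<in> E\<^sup>*"
    by (auto simp: conn_pairs_def)
  then have "\<forall>u<g. \<forall>v<g. (u, v) \<in> (cycle_arcs g)\<^sup>*"
    using rtrancl_mono by blast
  then show ?thesis
    using g by (auto simp: conn_pairs_def in_cycle_arcs_iff sym_def lessThan_empty_iff)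
qed

text \<open>Cut the cycle at a missing edge. Let \<open>s\<close> be the first vertex of
  \<open>V\<close> after the cut and follow \<open>E\<close> forward until an edge is missing. The
  stretch covered is closed under \<open>E\<close>, so connectedness makes it all of
  \<open>V\<close>.\<close>

lemma conn_pairs_cycle_cases:
  assumes "(V, E) \<in> conn_pairs {..<g} (cycle_arcs g)" "(V, E) \<noteq> ({..<g}, cycle_arcs g)"
  obtains s k where "s < g" "1 \<le> k" "k \<le> g" "(V, E) = cycle_path g s k"
proof -
  have VE: "V \<noteq> {}" "V \<subseteq> {..<g}" "E \<subseteq> cycle_arcs g" "sym E" "E \<subseteq> V \<times> V"
      "\<And>u v. u \<in> V \<Longrightarrow> v \<in> V \<Longrightarrow> (u, v) \<in> E\<^sup>*"
    using assms(1) by (auto simp: conn_pairs_def)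
  have "\<exists>x<g. (x, nxt x) \<notin> E"
  proof (rule ccontr)
    assume "\<not> (\<exists>x<g. (x, nxt x) \<notin> E)"
    then have all: "(x, nxt x) \<in> E" if "x < g" for x
      using that by blast
    then have "E = cycle_arcs g"
      using VE(3,4) by (auto simp: cycle_arcs_def dest: symD)
    moreover have "V = {..<g}"
      using all VE(2,5) by blast
    ultimately show False
      using assms(2) by simp
  qed
  then obtain x where x: "x < g" "(x, nxt x) \<notin> E" by blast

  \<comment> \<open>\<open>j\<close> counts steps from \<open>nxt x\<close>, the vertex just behind
    the cut; the least \<open>j\<close> that hits \<open>V\<close> gives the start.\<close>
  define P where "P j \<longleftrightarrow> (Suc x + j) mod g \<in> V" for j
  obtain v where v: "v \<in> V" using VE(1) by blast
  then have "v < g" using VE(2) by blast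
  have "(Suc x + (v + g - Suc x)) mod g = v"
    using \<open>v < g\<close> x(1) by simp
  then have "P (v + g - Suc x)"
    using v by (simp add: P_def)
  define j where "j = (LEAST j. P j)"
  have Pj: "P j"
    unfolding j_def using \<open>P (v + g - Suc x)\<close> by (rule LeastI)
  define s where "s = (Suc x + j) mod g"
  have s: "s \<in> V" "s < g"
    using Pj g by (auto simp: P_def s_def)
  \<comment> \<open>Either \<open>j = 0\<close> and the entering edge is the missing one, or the
    predecessor lies outside \<open>V\<close> by minimality of \<open>j\<close>.\<close>
  have pred: "(y, s) \<notin> E" if y: "y < g" "s = nxt y" for y
  proof (cases j)
    case 0
    then have "nxt y = nxt x"
      using y(2) by (simp add: s_def)
    then have "y = x"
      using y(1) x(1) by (rule Suc_mod_inj)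
    then show ?thesis using x(2) y by simp
  next
    case (Suc i)
    have "nxt ((Suc x + i) mod g) = nxt y"
      using y Suc nxt_shift[of "Suc x" i] by (simp add: s_def)
    then have "y = (Suc x + i) mod g"
      using Suc_mod_inj[of "(Suc x + i) mod g" g y] y(1) g by simp
    moreover have "\<not> P i"
      using not_less_Least[of i P] Suc unfolding j_def by simp
    ultimately show ?thesis
      using VE(5) by (auto simp: P_def)
  qed

  \<comment> \<open>The walk must stop by index \<open>g - 1\<close> at the latest, since the next
    step would enter \<open>s\<close>.\<close>
  define Q where "Q i \<longleftrightarrow> ((s + i) mod g, (s + Suc i) mod g) \<notin> E" for i
  have "(s + Suc (g - 1)) mod g = s"
    using s g by simp
  then have "Q (g - 1)"
    using pred[of "(s + (g - 1)) mod g"] nxt_shift[of s "g - 1"] g by (simp add: Q_def)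
  define l where "l = (LEAST i. Q i)"
  have Ql: "Q l"
    unfolding l_def using \<open>Q (g - 1)\<close> by (rule LeastI)
  have lg: "l < g"
    using Least_le[of Q, OF \<open>Q (g - 1)\<close>] g unfolding l_def by simp
  have arc: "((s + i) mod g, (s + Suc i) mod g) \<in> E" if "i < l" for i
    using not_less_Least[of i Q] that unfolding l_def Q_def by blast
  have inV: "(s + i) mod g \<in> V" if "i \<le> l" for i
    using that s arc[of "i - 1"] VE(5) by (cases i) auto
  \<comment> \<open>Going forward is blocked at \<open>l\<close> by \<open>Ql\<close>, going
    backward is blocked at \<open>s\<close> by \<open>pred\<close>.\<close>
  have closed: "\<exists>i'\<le>l. b = (s + i') mod g" if ab: "((s + i) mod g, b) \<in> E" "i \<le> l" for i b
  proof -
    have "b < g" and disj: "b = (s + Suc i) mod g \<or> (s + i) mod g = nxt b"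
      using ab VE(3) nxt_shift by (auto simp: in_cycle_arcs_iff subset_iff)
    from disj show ?thesis
    proof
      assume b: "b = (s + Suc i) mod g"
      then have "i \<noteq> l" using ab Ql by (auto simp: Q_def)
      then show ?thesis using b ab(2) by (metis Suc_leI le_neq_implies_less)
    next
      assume b: "(s + i) mod g = nxt b"
      show ?thesis
      proof (cases i)
        case 0
        then have "(s, b) \<in> E" "s = nxt b" using ab b s by auto
        then show ?thesis using pred[OF \<open>b < g\<close>] VE(4) by (auto dest: symD)
      next
        case (Suc i')
        then have "b = (s + i') mod g"
          using b nxt_shift[of s i'] Suc_mod_inj[of "(s + i') mod g" g b] \<open>b < g\<close> g by simp
        then show ?thesis using Suc ab(2) by (metis Suc_leD)
      qed
    qed
  qed
  have reach: "\<exists>i\<le>l. b = (s + i) mod g" if "(s, b) \<in> E\<^sup>*" for b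
    using that
  proof (induction rule: rtrancl_induct)
    case base
    show ?case using s by (intro exI[of _ 0]) simp
  next
    case (step y z)
    then show ?case using closed by blast
  qed
  have V: "V = (\<lambda>i. (s + i) mod g) ` {..<Suc l}"
  proof
    show "V \<subseteq> (\<lambda>i. (s + i) mod g) ` {..<Suc l}"
      using reach[OF VE(6)[OF s(1)]] by (fastforce simp: less_Suc_eq_le)
    show "(\<lambda>i. (s + i) mod g) ` {..<Suc l} \<subseteq> V"
      using inV by (simp add: image_subset_iff less_Suc_eq_le)
  qed
  have fwd: "\<exists>i<l. a = (s + i) mod g" if "(a, b) \<in> E" "b = nxt a" for a b
  proof -
    have "a \<in> V" using that VE(5) by blast
    then obtain i where i: "i \<le> l" "a = (s + i) mod g"
      using reach VE(6)[OF s(1)] by blast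
    moreover have "i \<noteq> l"
      using that i Ql nxt_shift[of s i] by (auto simp: Q_def)
    ultimately show ?thesis by (metis le_neq_implies_less)
  qed
  have E: "E = (\<Union>i\<in>{i. Suc i < Suc l}. {((s + i) mod g, (s + Suc i) mod g), ((s + Suc i) mod g, (s + i) mod g)})"
    (is "E = ?E")
  proof
    show "?E \<subseteq> E"
      using arc VE(4) by (auto dest: symD)
    show "E \<subseteq> ?E"
    proof clarify
      fix a b assume ab: "(a, b) \<in> E"
      then have "b = nxt a \<or> a = nxt b"
        using VE(3) by (auto simp: in_cycle_arcs_iff subset_iff)
      then show "(a, b) \<in> ?E"
      proof
        assume b: "b = nxt a"
        obtain i where "i < l" "a = (s + i) mod g"
          using fwd[OF ab b] by blast
        then show ?thesis using b nxt_shift[of s i] by auto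
      next
        assume a: "a = nxt b"
        obtain i where "i < l" "b = (s + i) mod g"
          using fwd[OF symD[OF VE(4) ab] a] by blast
        then show ?thesis using a nxt_shift[of s i] by auto
      qed
    qed
  qed
  \<comment> \<open>\<open>l\<close> counts edges, hence \<open>Suc l\<close> vertices.\<close>
  have "(V, E) = cycle_path g s (Suc l)"
    unfolding cycle_path_def using V E by blast
  then show ?thesis
    using that[of s "Suc l"] s lg by simp
qed

lemma conn_pairs_cycle:
  "conn_pairs {..<g} (cycle_arcs g) =
    insert ({..<g}, cycle_arcs g) ((\<lambda>(s, k). cycle_path g s k) ` ({..<g} \<times> {1..g}))" (is "?L = ?R")
proof
  show "?L \<subseteq> ?R"
  proof clarify
    fix V E assume X: "(V, E) \<in> ?L" "(V, E) \<notin> (\<lambda>(s, k). cycle_path g s k) ` ({..<g} \<times> {1..g})"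
    show "V = {..<g} \<and> E = cycle_arcs g"
    proof (rule ccontr)
      assume "\<not> (V = {..<g} \<and> E = cycle_arcs g)"
      then obtain s k where "s < g" "1 \<le> k" "k \<le> g" "(V, E) = cycle_path g s k"
        using conn_pairs_cycle_cases[OF X(1)] by blast
      then show False using X(2) by force
    qed
  qed
  show "?R \<subseteq> ?L"
    using whole_cycle_in_conn_pairs cycle_path_in_conn_pairs by auto
qed

lemma card_conn_pairs_cycle: "card (conn_pairs {..<g} (cycle_arcs g)) = g\<^sup>2 + 1"
proof -
  have "({..<g}, cycle_arcs g) \<notin> (\<lambda>(s, k). cycle_path g s k) ` ({..<g} \<times> {1..g})"
    using whole_cycle_not_path by fastforce
  moreover have "card ((\<lambda>(s, k). cycle_path g s k) ` ({..<g} \<times> {1..g})) = g * g"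
    by (subst card_image[OF inj_on_cycle_path]) simp
  ultimately show ?thesis
    by (simp add: conn_pairs_cycle power2_eq_square)
qed

text \<open>From \<open>s\<close> the vertex \<open>g - 1\<close> is first met after
  \<open>g - 1 - s\<close> steps, before any wrap-around, so membership is a linear
  inequality.\<close>

lemma last_in_cycle_path_iff:
  assumes "s < g" "1 \<le> k" "k \<le> g"
  shows "g - 1 \<in> fst (cycle_path g s k) \<longleftrightarrow> g \<le> s + k"
proof
  assume "g - 1 \<in> fst (cycle_path g s k)"
  then obtain i where "i \<in> {..<k}" and i: "g - 1 = (s + i) mod g"
    unfolding cycle_path_def fst_conv by (rule imageE)
  then have "i < k" by simp
  moreover have "g - 1 \<le> s + i"
    unfolding i by (rule mod_less_eq_dividend)
  ultimately show "g \<le> s + k" by simp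
next
  assume "g \<le> s + k"
  moreover have "(s + (g - 1 - s)) mod g = g - 1"
    using assms by simp
  ultimately show "g - 1 \<in> fst (cycle_path g s k)"
    using assms by (force simp: cycle_path_def intro!: image_eqI[of _ _ "g - 1 - s"])
qed

lemma card_conn_pairs_at_cycle:
  "2 * card (conn_pairs_at (g - 1) {..<g} (cycle_arcs g)) = g\<^sup>2 + g + 2"
proof -
  let ?T = "{(s, k). s < g \<and> 1 \<le> k \<and> k \<le> g \<and> g \<le> s + k}"
  have sub: "?T \<subseteq> {..<g} \<times> {1..g}" by auto
  have eq: "conn_pairs_at (g - 1) {..<g} (cycle_arcs g) =
      insert ({..<g}, cycle_arcs g) ((\<lambda>(s, k). cycle_path g s k) ` ?T)"
  proof -
    have "{X \<in> (\<lambda>(s, k). cycle_path g s k) ` ({..<g} \<times> {1..g}). g - 1 \<in> fst X} =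
        (\<lambda>(s, k). cycle_path g s k) ` {p \<in> {..<g} \<times> {1..g}. g - 1 \<in> fst (cycle_path g (fst p) (snd p))}"
      by (auto simp: case_prod_beta)
    also have "{p \<in> {..<g} \<times> {1..g}. g - 1 \<in> fst (cycle_path g (fst p) (snd p))} = ?T"
      using last_in_cycle_path_iff by auto
    finally have "{X \<in> (\<lambda>(s, k). cycle_path g s k) ` ({..<g} \<times> {1..g}). g - 1 \<in> fst X} =
        (\<lambda>(s, k). cycle_path g s k) ` ?T" .
    moreover have "{X \<in> insert A B. g - 1 \<in> fst X} = insert A {X \<in> B. g - 1 \<in> fst X}"
      if "g - 1 \<in> fst A" for A :: "nat set \<times> nat rel" and B
      using that by auto
    ultimately show ?thesis
      unfolding conn_pairs_at_def conn_pairs_cycle using g by simp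
  qed
  have "({..<g}, cycle_arcs g) \<notin> (\<lambda>(s, k). cycle_path g s k) ` ?T"
    using whole_cycle_not_path by fastforce
  moreover have "finite ?T"
    using sub by (rule finite_subset) simp
  moreover have "card ((\<lambda>(s, k). cycle_path g s k) ` ?T) = card ?T"
    by (rule card_image[OF inj_on_subset[OF inj_on_cycle_path sub]])
  ultimately have "card (conn_pairs_at (g - 1) {..<g} (cycle_arcs g)) = Suc (card ?T)"
    unfolding eq by simp
  \<comment> \<open>Each start \<open>s\<close> admits the \<open>Suc s\<close> lengths from
    \<open>g - s\<close> to \<open>g\<close>.\<close>
  moreover have "?T = Sigma {..<g} (\<lambda>s. {g - s..g})"
    by auto
  then have "card ?T = (\<Sum>s<g. Suc s)"
    by simp
  moreover have "2 * (\<Sum>s<g. Suc s) = g\<^sup>2 + g"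
    by (induction g) (auto simp: power2_eq_square)
  ultimately show ?thesis by simp
qed

end

section \<open>The core index of lollipop graphs\<close>

text \<open>With \<open>n = g\<close> the tail contributes no arcs; this degenerate lollipop starts
  the induction on the tail.\<close>

lemma parcs_lollipop_cycle: "parcs (lollipop g g) = cycle_arcs g"
  by (auto simp: lollipop_def parcs_mk_symmetric cycle_arcs_def)

lemma parcs_lollipop_Suc:
  assumes "1 \<le> g" "g \<le> n"
  shows "parcs (lollipop (Suc n) g) = parcs (lollipop n g) \<union> {(n - 1, n), (n, n - 1)}"
proof -
  have "{(i, Suc i) |i. g - 1 \<le> i \<and> i < Suc n - 1} =
      insert (n - 1, n) {(i, Suc i) |i. g - 1 \<le> i \<and> i < n - 1}"
    using assms by (auto simp: less_Suc_eq)
  then show ?thesis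
    unfolding lollipop_def parcs_mk_symmetric with_proj_simps pair_pre_digraph.simps by auto
qed

lemma parcs_lollipop_subset:
  assumes "1 \<le> g" "g \<le> n"
  shows "parcs (lollipop n g) \<subseteq> {..<n} \<times> {..<n}"
  using assms(2)
proof (induction n rule: dec_induct)
  case base
  then show ?case
    using assms(1) by (auto simp: parcs_lollipop_cycle cycle_arcs_def)
next
  case (step n)
  then show ?case
    using assms(1) by (auto simp: parcs_lollipop_Suc)
qed

text \<open>Both counts are needed in one induction: a new tail vertex raises the count through the
  end by one and the total by that new count. At \<open>m = 0\<close> the end is the identified
  vertex \<open>g - 1\<close>.\<close>

lemma card_conn_pairs_lollipop:
  assumes "3 \<le> g"
  shows "2 * card (conn_pairs_at (g + m - 1) {..<g + m} (parcs (lollipop (g + m) g))) =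
      g\<^sup>2 + g + 2 + 2 * m \<and>
    2 * card (conn_pairs {..<g + m} (parcs (lollipop (g + m) g))) =
      2 * g\<^sup>2 + 2 + m * (g\<^sup>2 + g + 2) + m * (m + 1)"
proof (induction m)
  case 0
  interpret cycle_graph g by unfold_locales fact
  show ?case
    using card_conn_pairs_cycle card_conn_pairs_at_cycle by (simp add: parcs_lollipop_cycle)
next
  case (Suc m)
  interpret pendant "{..<g + m}" "parcs (lollipop (g + m) g)" "g + m - 1" "g + m"
    using assms parcs_lollipop_subset[of g "g + m"] by unfold_locales auto
  have "parcs (lollipop (g + Suc m) g) =
      parcs (lollipop (g + m) g) \<union> {(g + m - 1, g + m), (g + m, g + m - 1)}"
    using parcs_lollipop_Suc[of g "g + m"] assms by simp
  moreover have "{..<g + Suc m} = insert (g + m) {..<g + m}"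
    by auto
  ultimately show ?case
    using Suc card_conn_pairs_at_pendant card_conn_pairs_pendant by (simp add: algebra_simps)
qed

text \<open>Integers let values for different \<open>g\<close> be subtracted without
  truncation.\<close>

lemma core_index_lollipop:
  assumes "3 \<le> g" "g < n"
  shows "2 * int (core_index (lollipop n g)) =
    2 * int g ^ 2 + 2 + (int n - int g) * (int g ^ 2 + int g + 2) +
    (int n - int g) * (int n - int g + 1)"
proof -
  obtain m where n: "n = g + m"
    using assms(2) less_imp_add_positive by blast
  have "2 * core_index (lollipop n g) = 2 * g\<^sup>2 + 2 + m * (g\<^sup>2 + g + 2) + m * (m + 1)"
    using card_conn_pairs_lollipop[OF assms(1), of m]
      core_index_eq_card_conn_pairs[OF pair_graph_lollipop[OF assms]]
    by (simp add: n atLeast0LessThan)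
  then have "int (2 * core_index (lollipop n g)) =
      int (2 * g\<^sup>2 + 2 + m * (g\<^sup>2 + g + 2) + m * (m + 1))"
    by simp
  then show ?thesis
    by (simp add: n algebra_simps)
qed

text \<open>The difference is positive exactly when the threshold condition, with its denominator
  cleared, holds at \<open>g\<close>.\<close>

lemma core_index_lollipop_Suc:
  assumes "3 \<le> g" "Suc g < n"
  shows "2 * int (core_index (lollipop n (Suc g))) - 2 * int (core_index (lollipop n g)) =
    2 * int g * int n - (3 * int g ^ 2 - int g + 2)"
proof -
  have "3 \<le> Suc g" "g < n"
    using assms by auto
  then show ?thesis
    unfolding core_index_lollipop[OF assms(1) \<open>g < n\<close>] core_index_lollipop[OF \<open>3 \<le> Suc g\<close> assms(2)]
    by (simp add: algebra_simps power2_eq_square)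
qed

lemma core_index_lollipop_triangle_less:
  assumes "3 < g" "g < n"
  shows "core_index (lollipop n 3) < core_index (lollipop n g)"
proof -
  have "2 * int (core_index (lollipop n g)) - 2 * int (core_index (lollipop n 3)) =
      (int g - 3) * (int g - 6 + (int n - int g) * (int g + 2))"
  proof -
    have "(3::nat) \<le> 3" "3 < n" "3 \<le> g"
      using assms by auto
    then show ?thesis
      unfolding core_index_lollipop[OF \<open>3 \<le> 3\<close> \<open>3 < n\<close>] core_index_lollipop[OF \<open>3 \<le> g\<close> assms(2)]
      by (simp add: algebra_simps power2_eq_square)
  qed
  moreover have "1 * (int g + 2) \<le> (int n - int g) * (int g + 2)"
    using assms by (intro mult_right_mono) auto
  then have "0 < int g - 6 + (int n - int g) * (int g + 2)"
    using assms(1) by arith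
  then have "0 < (int g - 3) * (int g - 6 + (int n - int g) * (int g + 2))"
    using assms by (intro mult_pos_pos) auto
  ultimately show ?thesis by simp
qed

section \<open>The threshold\<close>

lemma threshold_less_iff:
  assumes "g > 0"
  shows "(3 * real g ^ 2 - real g + 2) / (2 * real g) < real n \<longleftrightarrow>
    3 * int g ^ 2 - int g + 2 < 2 * int g * int n"
proof -
  have "(3 * real g ^ 2 - real g + 2) / (2 * real g) < real n \<longleftrightarrow>
      3 * real g ^ 2 - real g + 2 < 2 * real g * real n"
    using assms by (simp add: pos_divide_less_eq mult.commute)
  also have "\<dots> \<longleftrightarrow> real_of_int (3 * int g ^ 2 - int g + 2) < real_of_int (2 * int g * int n)"
    by simp
  finally show ?thesis
    by (simp only: of_int_less_iff)
qed

text \<open>The condition at \<open>g\<close> gives \<open>3 * g \<le> 2 * n\<close>. For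
  \<open>j < g\<close> this yields \<open>3 * (j + 1) \<le> 2 * n\<close>, and multiplying by
  \<open>j\<close> leaves a surplus of \<open>4 * j - 2 > 0\<close>.\<close>

lemma threshold_mono:
  fixes j g n :: int
  assumes "1 \<le> j" "j \<le> g" "3 * g ^ 2 - g + 2 < 2 * g * n"
  shows "3 * j ^ 2 - j + 2 < 2 * j * n"
proof (cases "j = g")
  case False
  have "g * (3 * g - 1) < g * (2 * n)"
    using assms(3) by (simp add: algebra_simps power2_eq_square)
  then have "3 * g \<le> 2 * n"
    using assms(1,2) by (simp add: mult_less_cancel_left_pos)
  moreover have "j + 1 \<le> g"
    using False assms(2) by simp
  ultimately have "3 * (j + 1) \<le> 2 * n"
    by simp
  then have "j * (3 * (j + 1)) \<le> j * (2 * n)"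
    using assms(1) by (intro mult_left_mono) auto
  then show ?thesis
    using assms(1) by (simp add: algebra_simps power2_eq_square)
qed (use assms in simp)

text \<open>Rules out ties between consecutive values, which makes the maximiser unique.\<close>

lemma threshold_neq:
  fixes j n :: int
  assumes "3 \<le> j"
  shows "3 * j ^ 2 - j + 2 \<noteq> 2 * j * n"
proof
  assume "3 * j ^ 2 - j + 2 = 2 * j * n"
  then have "2 = j * (2 * n - 3 * j + 1)"
    by (simp add: algebra_simps power2_eq_square)
  then have "j dvd 2" by (rule dvdI)
  then show False
    using assms zdvd_imp_le by fastforce
qed

theorem theorem4p10:
  fixes n g\<^sub>0 :: nat and G :: "'a pair_pre_digraph"
  assumes "n \<ge> 4"
    and "g\<^sub>0 > 0"
    and "(3 * real g\<^sub>0 ^ 2 - real g\<^sub>0 + 2) / (2 * real g\<^sub>0) < real n"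
    and "\<And>g :: nat. g > 0 \<Longrightarrow> (3 * real g ^ 2 - real g + 2) / (2 * real g) < real n \<Longrightarrow> g \<le> g\<^sub>0"
    and "pair_graph G"
    and "\<exists>g. 3 \<le> g \<and> g < n \<and> graph_iso G (lollipop n g)"
  shows "core_index (lollipop n 3) \<le> core_index G \<and>
    core_index G \<le> core_index (lollipop n (g\<^sub>0 + 1)) \<and>
    (core_index G = core_index (lollipop n 3) \<longleftrightarrow> graph_iso G (lollipop n 3)) \<and>
    (core_index G = core_index (lollipop n (g\<^sub>0 + 1)) \<longleftrightarrow> graph_iso G (lollipop n (g\<^sub>0 + 1)))"
proof -
  obtain g where g: "3 \<le> g" "g < n" "graph_iso G (lollipop n g)"
    using assms(6) by blast
  let ?F = "\<lambda>g. core_index (lollipop n g)"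
  have F_eq: "core_index G = ?F g'" if "3 \<le> g'" "g' < n" "graph_iso G (lollipop n g')" for g'
    using core_index_eq_if_graph_iso[OF assms(5) pair_graph_lollipop] that by blast
  have below: "3 * int g\<^sub>0 ^ 2 - int g\<^sub>0 + 2 < 2 * int g\<^sub>0 * int n"
    using assms(3) threshold_less_iff[OF assms(2)] by blast
  have above: "\<not> 3 * int j ^ 2 - int j + 2 < 2 * int j * int n" if "g\<^sub>0 < j" for j
    using assms(4)[of j] threshold_less_iff[of j] that by auto
  \<comment> \<open>At 2 the condition reads \<open>12 < 4 * n\<close>, which holds for
    \<open>n \<ge> 4\<close>.\<close>
  have "2 \<le> g\<^sub>0"
    using above[of 2] assms(1) by (cases "g\<^sub>0 < 2") auto
  \<comment> \<open>Otherwise the condition would hold at \<open>n - 1\<close>, where it amounts to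
    \<open>(n - 2) * (n - 3) < 0\<close>.\<close>
  moreover have "g\<^sub>0 + 1 < n"
  proof (rule ccontr)
    assume "\<not> g\<^sub>0 + 1 < n"
    then have "3 * (int n - 1) ^ 2 - (int n - 1) + 2 < 2 * (int n - 1) * int n"
      using threshold_mono[OF _ _ below, of "int n - 1"] assms(1) by simp
    moreover have "0 \<le> (int n - 2) * (int n - 3)"
      using assms(1) by (intro mult_nonneg_nonneg) auto
    ultimately show False
      by (simp add: algebra_simps power2_eq_square)
  qed
  ultimately have g\<^sub>0: "3 \<le> g\<^sub>0 + 1" "g\<^sub>0 + 1 < n" by auto
  \<comment> \<open>The increase still holds at \<open>j = g\<^sub>0\<close>, which is why the peak
    sits at \<open>g\<^sub>0 + 1\<close>.\<close>
  have incr: "?F j < ?F (Suc j)" if "3 \<le> j" "j \<le> g\<^sub>0" for j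
    using core_index_lollipop_Suc[of j n] threshold_mono[OF _ _ below, of "int j"] that g\<^sub>0 by simp
  have decr: "?F (Suc j) < ?F j" if "g\<^sub>0 < j" "Suc j < n" for j
    using core_index_lollipop_Suc[of j n] above[of j] threshold_neq[of "int j" "int n"] that g\<^sub>0
    by simp
  \<comment> \<open>The values rise strictly up to the peak and fall strictly after it; each side is
    chained by induction.\<close>
  have max: "?F g < ?F (g\<^sub>0 + 1)" if "g \<noteq> g\<^sub>0 + 1"
  proof (cases "g < g\<^sub>0 + 1")
    case True
    have "Suc g \<le> j \<Longrightarrow> j \<le> g\<^sub>0 + 1 \<Longrightarrow> ?F g < ?F j" for j
    proof (induction j rule: dec_induct)
      case base
      then show ?case using incr g(1) by simp
    next
      case (step j)
      then show ?case using incr[of j] g(1) by simp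
    qed
    then show ?thesis using True by simp
  next
    case False
    have "Suc (g\<^sub>0 + 1) \<le> j \<Longrightarrow> j < n \<Longrightarrow> ?F j < ?F (g\<^sub>0 + 1)" for j
    proof (induction j rule: dec_induct)
      case base
      then show ?case using decr[of "g\<^sub>0 + 1"] by simp
    next
      case (step j)
      then show ?case using decr[of j] by simp
    qed
    then show ?thesis using False that g(2) by simp
  qed
  have min: "?F 3 < ?F g" if "g \<noteq> 3"
    using core_index_lollipop_triangle_less[of g n] g that by simp
  \<comment> \<open>Strictness turns equality of indices into \<open>g = 3\<close>; the converse is
    invariance under isomorphism.\<close>
  have "core_index G = ?F 3 \<longleftrightarrow> graph_iso G (lollipop n 3)"
    using F_eq[of 3] F_eq[of g] g min assms(1) by (cases "g = 3") auto
  moreover have "core_index G = ?F (g\<^sub>0 + 1) \<longleftrightarrow> graph_iso G (lollipop n (g\<^sub>0 + 1))"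
    using F_eq[of "g\<^sub>0 + 1"] F_eq[of g] g g\<^sub>0 max by (cases "g = g\<^sub>0 + 1") auto
  moreover have "?F 3 \<le> ?F g" "?F g \<le> ?F (g\<^sub>0 + 1)"
    using min max by (cases "g = 3"; cases "g = g\<^sub>0 + 1"; simp)+
  ultimately show ?thesis
    using F_eq[OF g] by simp
qed

end
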